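(* Let $(\mathcal S,U,P)$ be a BCL triple with associated BCL pair $(M_{\phi_1},M_{\phi_2})$ on $H^2_{\mathcal S}(\mathbb T)$, and let $A:=UP^\perp UPU^*P^\perp U^*-P$, $B:=UP^\perp UPU^*PU^*$, $D:=UPUPU^*PU^*$. Then $H(M_{\phi_1},M_{\phi_2})\leq 0$ if and only if $A\leq 0$, $D\leq 0$ and $|\langle Bs,s\rangle|^2\le\langle As,s\rangle\langle Ds,s\rangle$ for all $s\in\mathcal S$.
   Context: A BCL triple $(\mathcal S,U,P)$ consists of a complex separable Hilbert space $\mathcal S$, a unitary $U$ on $\mathcal S$ and an orthogonal projection $P$ on $\mathcal S$; $P^\perp=I-P$. $H^2(\mathbb T)$ is the Hardy space of the circle, $S_z$ is multiplication by $z$ on it, and $H^2_{\mathcal S}(\mathbb T)$ ($\mathcal S$-valued Hardy space) is identified with $H^2(\mathbb T)\otimes\mathcal S$. The BCL pair is the commuting pair of isometries $M_{\phi_1}=I\otimes PU^*+S_z\otimes P^\perp U^*$, $M_{\phi_2}=I\otimes UP^\perp+S_z\otimes UP$. For commuting isometries $(V_1,V_2)$, $H(V_1,V_2):=V_2V_2^*-V_1V_1^*-V_2^2V_2^{*2}+V_1V_2V_1^*V_2^*$. *)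

theory Defs
  imports "HOL-Analysis.Analysis" "HOL-Library.Complex_Order"
begin

section \<open>Complex inner product spaces and Hilbert spaces\<close>

text \<open>The complex inner product is linear in the first argument; \<^const>\<open>inner\<close> is its real part.
  Positive definiteness is inherited from \<^class>\<open>real_inner\<close>, since \<open>cinner x x\<close> is real by
  \<open>cinner_commute\<close>.\<close>

class complex_inner = real_inner +
  fixes scaleC :: "complex \<Rightarrow> 'a \<Rightarrow> 'a"  (infixr \<open>*\<^sub>C\<close> 75)
    and cinner :: "'a \<Rightarrow> 'a \<Rightarrow> complex"
  assumes scaleC_add_right: "c *\<^sub>C (x + y) = c *\<^sub>C x + c *\<^sub>C y"
    and scaleC_add_left: "(c + d) *\<^sub>C x = c *\<^sub>C x + d *\<^sub>C x"
    and scaleC_scaleC: "c *\<^sub>C d *\<^sub>C x = (c * d) *\<^sub>C x"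
    and scaleC_of_real: "complex_of_real r *\<^sub>C x = r *\<^sub>R x"
    and cinner_commute: "cinner x y = cnj (cinner y x)"
    and cinner_add_left: "cinner (x + y) z = cinner x z + cinner y z"
    and cinner_scaleC_left: "cinner (c *\<^sub>C x) y = c * cinner x y"
    and Re_cinner: "Re (cinner x y) = inner x y"

class complex_hilbert = complex_inner + banach

instantiation complex :: complex_hilbert
begin

definition scaleC_complex :: "complex \<Rightarrow> complex \<Rightarrow> complex" where "c *\<^sub>C x = c * (x::complex)"
definition cinner_complex :: "complex \<Rightarrow> complex \<Rightarrow> complex" where "cinner x y = x * cnj y"

instance
  by standard (auto simp: scaleC_complex_def cinner_complex_def inner_complex_def algebra_simps
      scaleR_conv_of_real)

end

lemma cinner_add_right: "cinner z (x + y) = cinner z x + cinner z (y::'a::complex_inner)"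
  by (metis cinner_commute cinner_add_left complex_cnj_add)

lemma cinner_scaleC_right: "cinner x (c *\<^sub>C y) = cnj c * cinner x (y::'a::complex_inner)"
  by (metis cinner_commute cinner_scaleC_left complex_cnj_mult)

lemma cinner_self: "cinner x x = complex_of_real ((norm (x::'a::complex_inner))\<^sup>2)"
proof -
  have "Im (cinner x x) = 0"
    using arg_cong[OF cinner_commute[of x x], of Im] by simp
  then show ?thesis
    by (simp add: complex_eq_iff Re_cinner power2_norm_eq_inner)
qed

lemma norm_scaleC: "norm (c *\<^sub>C (x::'a::complex_inner)) = cmod c * norm x"
proof -
  have "complex_of_real ((norm (c *\<^sub>C x))\<^sup>2) = complex_of_real ((cmod c * norm x)\<^sup>2)"
    unfolding cinner_self[symmetric] cinner_scaleC_left cinner_scaleC_right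
    by (simp add: cinner_self power_mult_distrib complex_norm_square del: of_real_power)
  then have "(norm (c *\<^sub>C x))\<^sup>2 = (cmod c * norm x)\<^sup>2"
    using of_real_eq_iff by blast
  then show ?thesis
    by (simp add: power2_eq_iff_nonneg)
qed

lemma cmod_cinner_le: "cmod (cinner x y) \<le> norm x * norm (y::'a::complex_inner)"
proof (cases "cinner x y = 0")
  case False
  define c where "c = cnj (cinner x y) / cmod (cinner x y)"
  have c: "cmod c = 1" using False by (simp add: c_def norm_divide)
  have "c * cinner x y = complex_of_real (cmod (cinner x y))"
    using False by (simp add: c_def complex_norm_square[symmetric] mult.commute power2_eq_square)
  then have "cmod (cinner x y) = Re (cinner (c *\<^sub>C x) y)"
    by (simp add: cinner_scaleC_left)
  also have "\<dots> \<le> norm (c *\<^sub>C x) * norm y"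
    by (simp add: Re_cinner norm_cauchy_schwarz)
  finally show ?thesis by (simp add: norm_scaleC c)
qed simp

lemma scaleC_scaleR: "c *\<^sub>C r *\<^sub>R x = r *\<^sub>R c *\<^sub>C (x::'a::complex_inner)"
  by (metis scaleC_of_real scaleC_scaleC mult.commute)

lemma bounded_bilinear_scaleC: "bounded_bilinear ((*\<^sub>C) :: complex \<Rightarrow> 'a::complex_inner \<Rightarrow> 'a)"
proof
  show "\<exists>K. \<forall>a (b::'a). norm (a *\<^sub>C b) \<le> norm a * norm b * K"
    by (rule exI[of _ 1]) (simp add: norm_scaleC)
  fix r :: real and a :: complex and b :: 'a
  show "(r *\<^sub>R a) *\<^sub>C b = r *\<^sub>R a *\<^sub>C b"
    by (metis scaleC_of_real scaleC_scaleC scaleR_conv_of_real)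
qed (simp_all add: scaleC_add_left scaleC_add_right scaleC_scaleR)

lemma bounded_bilinear_cinner: "bounded_bilinear (cinner :: 'a::complex_inner \<Rightarrow> 'a \<Rightarrow> complex)"
proof
  show "\<exists>K. \<forall>a (b::'a). norm (cinner a b) \<le> norm a * norm b * K"
    by (rule exI[of _ 1]) (simp add: cmod_cinner_le)
  fix r :: real and a b :: 'a
  show "cinner (r *\<^sub>R a) b = r *\<^sub>R cinner a b"
    by (metis cinner_scaleC_left scaleC_of_real scaleR_conv_of_real)
  show "cinner a (r *\<^sub>R b) = r *\<^sub>R cinner a b"
    by (metis cinner_scaleC_right complex_cnj_complex_of_real scaleC_of_real scaleR_conv_of_real)
qed (simp_all add: cinner_add_left cinner_add_right)


section \<open>Operators\<close>

definition bounded_clinear :: "('a::complex_inner \<Rightarrow> 'b::complex_inner) \<Rightarrow> bool" where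
  "bounded_clinear T \<longleftrightarrow> bounded_linear T \<and> (\<forall>c x. T (c *\<^sub>C x) = c *\<^sub>C T x)"

text \<open>The adjoint is unique if it exists; every bounded operator on a Hilbert space has one.\<close>

definition cadjoint :: "('a::complex_inner \<Rightarrow> 'b::complex_inner) \<Rightarrow> 'b \<Rightarrow> 'a" where
  "cadjoint T = (SOME T'. \<forall>x y. cinner (T x) y = cinner x (T' y))"

lemma cadjoint_unique:
  fixes T :: "'a::complex_inner \<Rightarrow> 'b::complex_inner"
  assumes "\<And>x y. cinner (T x) y = cinner x (T' y)"
  shows "cadjoint T = T'"
proof
  fix y
  have "\<forall>x y. cinner (T x) y = cinner x (cadjoint T y)"
    unfolding cadjoint_def by (rule someI[of _ T']) (use assms in blast)
  then have "\<And>x. inner x (cadjoint T y) = inner x (T' y)"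
    by (metis assms Re_cinner)
  then show "cadjoint T y = T' y"
    by (metis vector_eq_ldot)
qed

definition unitary_op :: "('a::complex_inner \<Rightarrow> 'a) \<Rightarrow> bool" where
  "unitary_op U \<longleftrightarrow> bounded_clinear U \<and> surj U \<and> (\<forall>x y. cinner (U x) (U y) = cinner x y)"

definition orthogonal_projection_op :: "('a::complex_inner \<Rightarrow> 'a) \<Rightarrow> bool" where
  "orthogonal_projection_op P \<longleftrightarrow>
     bounded_clinear P \<and> P \<circ> P = P \<and> (\<forall>x y. cinner (P x) y = cinner x (P y))"

text \<open>\<open>T \<le> 0\<close>. The order on \<^typ>\<open>complex\<close> makes \<open>w \<le> 0\<close> mean that \<open>w\<close> is real and nonpositive.\<close>

definition nonpositive_op :: "('a::complex_inner \<Rightarrow> 'a) \<Rightarrow> bool" where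
  "nonpositive_op T \<longleftrightarrow> (\<forall>x. cinner (T x) x \<le> 0)"

definition H_op ::
  "('a::complex_inner \<Rightarrow> 'a) \<Rightarrow> ('a \<Rightarrow> 'a) \<Rightarrow> 'a \<Rightarrow> 'a" where
  "H_op V1 V2 = (\<lambda>x. (V2 \<circ> cadjoint V2) x - (V1 \<circ> cadjoint V1) x
      - (V2 \<circ> V2 \<circ> cadjoint V2 \<circ> cadjoint V2) x
      + (V1 \<circ> V2 \<circ> cadjoint V1 \<circ> cadjoint V2) x)"


section \<open>The vector-valued Hardy space of the circle\<close>

text \<open>Normalised arc length on the unit circle, as a Borel measure on \<^typ>\<open>complex\<close> carried by the
  circle. Functions on the circle are represented by functions on \<^typ>\<open>complex\<close>; their values off the
  circle are irrelevant because functions are identified almost everywhere.\<close>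

definition circle_measure :: "complex measure" where
  "circle_measure = distr (uniform_measure lborel {0..<2 * pi}) borel cis"

definition fourier_coeff ::
  "(complex \<Rightarrow> 'a::{complex_hilbert,second_countable_topology}) \<Rightarrow> int \<Rightarrow> 'a" where
  "fourier_coeff f n = (\<integral>z. (z powi (- n)) *\<^sub>C f z \<partial>circle_measure)"

definition hardy_functions ::
  "(complex \<Rightarrow> 'a::{complex_hilbert,second_countable_topology}) set" where
  "hardy_functions = {f \<in> borel_measurable circle_measure.
     integrable circle_measure (\<lambda>z. (norm (f z))\<^sup>2) \<and> (\<forall>n<0. fourier_coeff f n = 0)}"

definition hardy_rel ::
  "(complex \<Rightarrow> 'a::{complex_hilbert,second_countable_topology}) \<Rightarrow> (complex \<Rightarrow> 'a) \<Rightarrow> bool" where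
  "hardy_rel f g \<longleftrightarrow> f \<in> hardy_functions \<and> g \<in> hardy_functions \<and> (AE z in circle_measure. f z = g z)"

lemma sets_circle_measure [measurable_cong, simp]: "sets circle_measure = sets borel"
  by (simp add: circle_measure_def)

lemma cis_borel_measurable [measurable]: "cis \<in> borel_measurable borel"
  by (intro borel_measurable_continuous_onI continuous_intros)

lemma emeasure_circle_measure: "emeasure circle_measure UNIV = 1"
  unfolding circle_measure_def
  by (subst emeasure_distr) (auto simp: emeasure_uniform_measure ennreal_divide_self)

interpretation circle: finite_measure circle_measure
proof
  have "space circle_measure = UNIV" by (simp add: circle_measure_def)
  then show "emeasure circle_measure (space circle_measure) \<noteq> \<infinity>"
    by (simp add: emeasure_circle_measure)
qed

lemma AE_circle_measure: "AE z in circle_measure. cmod z = 1"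
  unfolding circle_measure_def by (subst AE_distr_iff) auto

lemma hardy_zero: "(\<lambda>_. 0) \<in> hardy_functions"
  by (simp add: hardy_functions_def fourier_coeff_def
      bounded_bilinear.zero_right[OF bounded_bilinear_scaleC])

lemma part_equivp_hardy_rel: "part_equivp hardy_rel"
proof (rule part_equivpI)
  show "\<exists>f. hardy_rel f f" using hardy_zero by (auto simp: hardy_rel_def)
  show "symp hardy_rel"
    by (auto simp: symp_def hardy_rel_def elim: AE_mp)
  show "transp hardy_rel"
    unfolding transp_def hardy_rel_def by (auto elim: AE_mp)
qed

quotient_type (overloaded) 'a hardy =
  "complex \<Rightarrow> 'a::{complex_hilbert,second_countable_topology}" / partial: hardy_rel
  by (rule part_equivp_hardy_rel)

lemma measurable_scaleC [measurable]:
  fixes f :: "'b \<Rightarrow> 'a::{complex_hilbert,second_countable_topology}"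
  assumes "g \<in> borel_measurable M" "f \<in> borel_measurable M"
  shows "(\<lambda>z. g z *\<^sub>C f z) \<in> borel_measurable M"
  using assms(1,2)
  by (rule borel_measurable_continuous_Pair)
     (intro bounded_bilinear.continuous_on[OF bounded_bilinear_scaleC] continuous_intros)

lemma measurable_cinner [measurable]:
  fixes f g :: "'b \<Rightarrow> 'a::{complex_hilbert,second_countable_topology}"
  assumes "f \<in> borel_measurable M" "g \<in> borel_measurable M"
  shows "(\<lambda>z. cinner (f z) (g z)) \<in> borel_measurable M"
  using assms(1,2)
  by (rule borel_measurable_continuous_Pair)
     (intro bounded_bilinear.continuous_on[OF bounded_bilinear_cinner] continuous_intros)

lemma mult_le_squares: "(a::real) * b \<le> a\<^sup>2 + b\<^sup>2"
proof -
  have "2 * (a * b) \<le> a\<^sup>2 + b\<^sup>2" using zero_le_power2[of "a - b"] by (simp add: power2_diff)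
  moreover have "0 \<le> a\<^sup>2" "0 \<le> b\<^sup>2" by auto
  ultimately show ?thesis by linarith
qed

lemma integrable_cinner:
  fixes f g :: "'b \<Rightarrow> 'a::{complex_hilbert,second_countable_topology}"
  assumes [measurable]: "f \<in> borel_measurable M" "g \<in> borel_measurable M"
    and "integrable M (\<lambda>z. (norm (f z))\<^sup>2)" "integrable M (\<lambda>z. (norm (g z))\<^sup>2)"
  shows "integrable M (\<lambda>z. cinner (f z) (g z))"
  by (rule Bochner_Integration.integrable_bound[OF Bochner_Integration.integrable_add[OF assms(3,4)]])
     (auto intro!: AE_I2 order_trans[OF cmod_cinner_le] order_trans[OF mult_le_squares])

lemma hardy_functionsD:
  assumes "f \<in> hardy_functions"
  shows "f \<in> borel_measurable circle_measure"
    and "integrable circle_measure (\<lambda>z. (norm (f z))\<^sup>2)"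
    and "n < 0 \<Longrightarrow> fourier_coeff f n = 0"
  using assms by (auto simp: hardy_functions_def)

lemma measurable_powi [measurable]: "(\<lambda>z::complex. z powi n) \<in> borel_measurable borel"
  by (cases n rule: int_cases2) (simp_all add: power_int_minus)

text \<open>The integrands of the Fourier coefficients are integrable, so that \<^const>\<open>fourier_coeff\<close>
  never takes the default value 0 of a divergent Bochner integral.\<close>

lemma integrable_fourier:
  fixes f :: "complex \<Rightarrow> 'a::{complex_hilbert,second_countable_topology}"
  assumes [measurable]: "f \<in> borel_measurable circle_measure"
    and "integrable circle_measure (\<lambda>z. (norm (f z))\<^sup>2)"
  shows "integrable circle_measure (\<lambda>z. (z powi n) *\<^sub>C f z)"
proof (rule Bochner_Integration.integrable_bound)
  show "integrable circle_measure (\<lambda>z. 1 + (norm (f z))\<^sup>2)"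
    using assms by simp
  show "AE z in circle_measure. norm ((z powi n) *\<^sub>C f z) \<le> norm (1 + (norm (f z))\<^sup>2)"
    using AE_circle_measure
  proof eventually_elim
    case (elim z)
    then show ?case
      using mult_le_squares[of 1 "norm (f z)"] by (simp add: norm_scaleC norm_power_int)
  qed
qed simp

lemma hardy_add:
  assumes f: "f \<in> hardy_functions" and g: "g \<in> hardy_functions"
  shows "(\<lambda>z. f z + g z) \<in> hardy_functions"
proof -
  note [measurable] = hardy_functionsD(1)[OF f] hardy_functionsD(1)[OF g]
  have "integrable circle_measure (\<lambda>z. (norm (f z + g z))\<^sup>2)"
  proof (rule Bochner_Integration.integrable_bound)
    show "integrable circle_measure (\<lambda>z. 2 * (norm (f z))\<^sup>2 + 2 * (norm (g z))\<^sup>2)"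
      using hardy_functionsD(2)[OF f] hardy_functionsD(2)[OF g] by simp
    have "(norm (f z + g z))\<^sup>2 \<le> 2 * (norm (f z))\<^sup>2 + 2 * (norm (g z))\<^sup>2" for z
    proof -
      have "(norm (f z + g z))\<^sup>2 \<le> (norm (f z) + norm (g z))\<^sup>2"
        by (simp add: norm_triangle_ineq power_mono)
      also have "\<dots> \<le> 2 * (norm (f z))\<^sup>2 + 2 * (norm (g z))\<^sup>2"
        using zero_le_power2[of "norm (f z) - norm (g z)"]
        unfolding power2_diff power2_sum by linarith
      finally show ?thesis .
    qed
    then show "AE z in circle_measure.
        norm ((norm (f z + g z))\<^sup>2) \<le> norm (2 * (norm (f z))\<^sup>2 + 2 * (norm (g z))\<^sup>2)"
      by (auto intro!: AE_I2)
  qed measurable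
  moreover have "fourier_coeff (\<lambda>z. f z + g z) n = 0" if "n < 0" for n
    using hardy_functionsD(3)[OF f that] hardy_functionsD(3)[OF g that]
      integrable_fourier[OF hardy_functionsD(1,2)[OF f], of "-n"]
      integrable_fourier[OF hardy_functionsD(1,2)[OF g], of "-n"]
    by (simp add: fourier_coeff_def scaleC_add_right)
  ultimately show ?thesis by (simp add: hardy_functions_def)
qed

lemma hardy_bounded_clinear:
  assumes T: "bounded_clinear T" and f: "f \<in> hardy_functions"
  shows "(\<lambda>z. T (f z)) \<in> hardy_functions"
proof -
  note [measurable] = hardy_functionsD(1)[OF f]
  have bl: "bounded_linear T" and sc: "\<And>c x. T (c *\<^sub>C x) = c *\<^sub>C T x"
    using T by (auto simp: bounded_clinear_def)
  have [measurable]: "T \<in> borel_measurable borel"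
    by (intro borel_measurable_continuous_onI linear_continuous_on bl)
  obtain K where K: "\<And>x. norm (T x) \<le> norm x * K"
    using bounded_linear.bounded[OF bl] by blast
  have "integrable circle_measure (\<lambda>z. (norm (T (f z)))\<^sup>2)"
  proof (rule Bochner_Integration.integrable_bound)
    show "integrable circle_measure (\<lambda>z. (norm (f z))\<^sup>2 * K\<^sup>2)"
      using hardy_functionsD(2)[OF f] by simp
    show "AE z in circle_measure. norm ((norm (T (f z)))\<^sup>2) \<le> norm ((norm (f z))\<^sup>2 * K\<^sup>2)"
      using K by (auto intro!: AE_I2 power_mono simp: power_mult_distrib[symmetric])
  qed measurable
  moreover have "fourier_coeff (\<lambda>z. T (f z)) n = 0" if "n < 0" for n
    using integral_bounded_linear[OF bl integrable_fourier[OF hardy_functionsD(1,2)[OF f], of "-n"]]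
      hardy_functionsD(3)[OF f that] linear_simps(3)[OF bl]
    by (simp add: fourier_coeff_def sc)
  ultimately show ?thesis by (simp add: hardy_functions_def)
qed

lemma hardy_shift:
  assumes f: "f \<in> hardy_functions"
  shows "(\<lambda>z. z *\<^sub>C f z) \<in> hardy_functions"
proof -
  note [measurable] = hardy_functionsD(1)[OF f]
  have "integrable circle_measure (\<lambda>z. (norm (z *\<^sub>C f z))\<^sup>2)"
    by (rule Bochner_Integration.integrable_bound[OF hardy_functionsD(2)[OF f]])
       (use AE_circle_measure in \<open>auto simp: norm_scaleC\<close>)
  moreover have "fourier_coeff (\<lambda>z. z *\<^sub>C f z) n = 0" if "n < 0" for n
  proof -
    have "fourier_coeff (\<lambda>z. z *\<^sub>C f z) n = fourier_coeff f (n - 1)"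
      unfolding fourier_coeff_def
    proof (rule integral_cong_AE)
      show "AE z in circle_measure.
          (z powi (- n)) *\<^sub>C z *\<^sub>C f z = (z powi (- (n - 1))) *\<^sub>C f z"
        using AE_circle_measure
      proof eventually_elim
        case (elim z)
        then have "z \<noteq> 0" by auto
        then have "z powi (- n) * z = z powi (- (n - 1))"
          using power_int_add_1[of z "-n"] by (simp add: algebra_simps)
        then show ?case by (simp add: scaleC_scaleC)
      qed
    qed measurable
    then show ?thesis using hardy_functionsD(3)[OF f] that by simp
  qed
  ultimately show ?thesis by (simp add: hardy_functions_def)
qed

lemma bounded_clinear_scaleC: "bounded_clinear (\<lambda>x. c *\<^sub>C (x::'a::complex_inner))"
  by (simp add: bounded_clinear_def scaleC_scaleC mult.commute
      bounded_bilinear.bounded_linear_right[OF bounded_bilinear_scaleC])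

instantiation hardy :: ("{complex_hilbert,second_countable_topology}") complex_inner
begin

lift_definition zero_hardy :: "'a hardy" is "\<lambda>_. 0"
  by (simp add: hardy_rel_def hardy_zero)

lift_definition plus_hardy :: "'a hardy \<Rightarrow> 'a hardy \<Rightarrow> 'a hardy" is "\<lambda>f g z. f z + g z"
  by (auto simp: hardy_rel_def hardy_add)

lift_definition scaleC_hardy :: "complex \<Rightarrow> 'a hardy \<Rightarrow> 'a hardy" is "\<lambda>c f z. c *\<^sub>C f z"
  by (auto simp: hardy_rel_def hardy_bounded_clinear[OF bounded_clinear_scaleC])

definition uminus_hardy :: "'a hardy \<Rightarrow> 'a hardy" where "- F = (-1) *\<^sub>C (F::'a hardy)"
definition minus_hardy :: "'a hardy \<Rightarrow> 'a hardy \<Rightarrow> 'a hardy" where "F - G = F + - (G::'a hardy)"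
definition scaleR_hardy :: "real \<Rightarrow> 'a hardy \<Rightarrow> 'a hardy" where
  "r *\<^sub>R F = complex_of_real r *\<^sub>C (F::'a hardy)"

lift_definition cinner_hardy :: "'a hardy \<Rightarrow> 'a hardy \<Rightarrow> complex" is
  "\<lambda>f g. \<integral>z. cinner (f z) (g z) \<partial>circle_measure"
  by (auto simp: hardy_rel_def hardy_functions_def intro!: integral_cong_AE)

definition inner_hardy :: "'a hardy \<Rightarrow> 'a hardy \<Rightarrow> real" where "inner F G = Re (cinner F (G::'a hardy))"
definition norm_hardy :: "'a hardy \<Rightarrow> real" where "norm F = sqrt (inner F (F::'a hardy))"
definition sgn_hardy :: "'a hardy \<Rightarrow> 'a hardy" where "sgn F = inverse (norm F) *\<^sub>R (F::'a hardy)"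
definition dist_hardy :: "'a hardy \<Rightarrow> 'a hardy \<Rightarrow> real" where "dist F G = norm (F - (G::'a hardy))"
definition uniformity_hardy :: "('a hardy \<times> 'a hardy) filter" where
  "uniformity_hardy = (INF e\<in>{0<..}. principal {(F, G). dist F (G::'a hardy) < e})"
definition open_hardy :: "'a hardy set \<Rightarrow> bool" where
  "open_hardy S = (\<forall>F\<in>S. \<forall>\<^sub>F (F', G) in uniformity. F' = F \<longrightarrow> G \<in> S)"

instance
proof
  fix F G K :: "'a hardy" and c d :: complex and r s :: real and S :: "'a hardy set"
  have add_left: "(c + d) *\<^sub>C F = c *\<^sub>C F + d *\<^sub>C F" for c d and F :: "'a hardy"
    by transfer (auto simp: hardy_rel_def scaleC_add_left
        intro!: hardy_add hardy_bounded_clinear[OF bounded_clinear_scaleC])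
  have add_right: "c *\<^sub>C (F + G) = c *\<^sub>C F + c *\<^sub>C G" for c and F G :: "'a hardy"
    by transfer (auto simp: hardy_rel_def scaleC_add_right
        intro!: hardy_add hardy_bounded_clinear[OF bounded_clinear_scaleC])
  have scale_scale: "c *\<^sub>C d *\<^sub>C F = (c * d) *\<^sub>C F" for c d and F :: "'a hardy"
    by transfer (auto simp: hardy_rel_def scaleC_scaleC
        intro!: hardy_bounded_clinear[OF bounded_clinear_scaleC])
  have one: "1 *\<^sub>C F = F" for F :: "'a hardy"
    by transfer (auto simp: hardy_rel_def scaleC_of_real[of 1, simplified])
  have zero: "0 *\<^sub>C F = 0" for F :: "'a hardy"
    by transfer (auto simp: hardy_rel_def hardy_zero bounded_bilinear.zero_left[OF bounded_bilinear_scaleC])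
  have comm: "cinner F G = cnj (cinner G F)" for F G :: "'a hardy"
  proof transfer
    fix f g :: "complex \<Rightarrow> 'a"
    have "(\<lambda>z. cinner (f z) (g z)) = (\<lambda>z. cnj (cinner (g z) (f z)))"
      by (rule ext) (rule cinner_commute)
    then show "(\<integral>z. cinner (f z) (g z) \<partial>circle_measure) =
        cnj (\<integral>z. cinner (g z) (f z) \<partial>circle_measure)"
      by (simp only: Bochner_Integration.integral_cnj)
  qed
  have cadd: "cinner (F + G) K = cinner F K + cinner G K" for F G K :: "'a hardy"
    by transfer (simp add: hardy_rel_def cinner_add_left integrable_cinner hardy_functionsD)
  have cscale: "cinner (c *\<^sub>C F) G = c * cinner F G" for c and F G :: "'a hardy"
    by transfer (simp add: cinner_scaleC_left)
  have nonneg: "0 \<le> Re (cinner F F)" for F :: "'a hardy"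
    by transfer (simp add: cinner_self del: of_real_power)
  have eq_zero: "Re (cinner F F) = 0 \<longleftrightarrow> F = 0" for F :: "'a hardy"
  proof transfer
    fix f :: "complex \<Rightarrow> 'a"
    assume "hardy_rel f f"
    then have f: "f \<in> hardy_functions" by (simp add: hardy_rel_def)
    have "Re (\<integral>z. cinner (f z) (f z) \<partial>circle_measure) = (\<integral>z. (norm (f z))\<^sup>2 \<partial>circle_measure)"
      by (simp add: cinner_self del: of_real_power)
    also have "\<dots> = 0 \<longleftrightarrow> (AE z in circle_measure. f z = 0)"
      by (subst integral_nonneg_eq_0_iff_AE[OF hardy_functionsD(2)[OF f]]) auto
    finally show "Re (\<integral>z. cinner (f z) (f z) \<partial>circle_measure) = 0 \<longleftrightarrow> hardy_rel f (\<lambda>_. 0)"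
      using f by (simp add: hardy_rel_def hardy_zero)
  qed
  show "F + G + K = F + (G + K)"
    by transfer (auto simp: hardy_rel_def add.assoc intro!: hardy_add)
  show "F + G = G + F"
    by transfer (auto simp: hardy_rel_def add.commute intro!: hardy_add)
  show "0 + F = F"
    by transfer (auto simp: hardy_rel_def)
  show "- F + F = 0"
    using add_left[of "-1" 1 F] by (simp add: uminus_hardy_def one zero)
  show "F - G = F + - G" by (simp add: minus_hardy_def)
  show "r *\<^sub>R (F + G) = r *\<^sub>R F + r *\<^sub>R G"
    by (simp add: scaleR_hardy_def add_right)
  show "(r + s) *\<^sub>R F = r *\<^sub>R F + s *\<^sub>R F"
    by (simp add: scaleR_hardy_def add_left)
  show "r *\<^sub>R s *\<^sub>R F = (r * s) *\<^sub>R F"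
    by (simp add: scaleR_hardy_def scale_scale)
  show "1 *\<^sub>R F = F" by (simp add: scaleR_hardy_def one)
  show "sgn F = inverse (norm F) *\<^sub>R F" by (rule sgn_hardy_def)
  show "dist F G = norm (F - G)" by (rule dist_hardy_def)
  show "uniformity = (INF e\<in>{0<..}. principal {(F, G). dist F (G::'a hardy) < e})"
    by (rule uniformity_hardy_def)
  show "open S = (\<forall>F\<in>S. \<forall>\<^sub>F (F', G) in uniformity. F' = F \<longrightarrow> G \<in> S)"
    by (rule open_hardy_def)
  show "inner F G = inner G F"
    using comm[of F G] by (simp add: inner_hardy_def)
  show "inner (F + G) K = inner F K + inner G K" by (simp add: inner_hardy_def cadd)
  show "inner (r *\<^sub>R F) G = r * inner F G"
    by (simp add: inner_hardy_def scaleR_hardy_def cscale)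
  show "0 \<le> inner F F" by (simp add: inner_hardy_def nonneg)
  show "inner F F = 0 \<longleftrightarrow> F = 0" by (simp add: inner_hardy_def eq_zero)
  show "norm F = sqrt (inner F F)" by (rule norm_hardy_def)
  show "c *\<^sub>C (F + G) = c *\<^sub>C F + c *\<^sub>C G" by (rule add_right)
  show "(c + d) *\<^sub>C F = c *\<^sub>C F + d *\<^sub>C F" by (rule add_left)
  show "c *\<^sub>C d *\<^sub>C F = (c * d) *\<^sub>C F" by (rule scale_scale)
  show "complex_of_real r *\<^sub>C F = r *\<^sub>R F" by (simp add: scaleR_hardy_def)
  show "cinner F G = cnj (cinner G F)" by (rule comm)
  show "cinner (F + G) K = cinner F K + cinner G K" by (rule cadd)
  show "cinner (c *\<^sub>C F) G = c * cinner F G" by (rule cscale)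
  show "Re (cinner F G) = inner F G" by (simp add: inner_hardy_def)
qed

end

text \<open>Under \<open>H\<^sup>2(\<bbbT>) \<otimes> S = H\<^sup>2\<^sub>S(\<bbbT>)\<close>, where \<open>g \<otimes> s\<close> is the function \<open>z \<mapsto> g(z) s\<close>, the operator
  \<open>M\<^sub>h \<otimes> X\<close> (\<open>M\<^sub>h\<close> multiplication by \<open>h\<close> on \<open>H\<^sup>2(\<bbbT>)\<close>) maps \<open>F\<close> to the function
  \<open>z \<mapsto> h(z) X(F(z))\<close>. Only \<open>h = 1\<close> and \<open>h = z\<close> are used, with bounded \<open>X\<close>; for these the
  right-hand side is again in \<open>H\<^sup>2\<^sub>S(\<bbbT>)\<close> and independent of the representative, as the two
  lemmas following the definition show.\<close>

definition mult_tensor ::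
  "(complex \<Rightarrow> complex) \<Rightarrow> ('a \<Rightarrow> 'a) \<Rightarrow> 'a::{complex_hilbert,second_countable_topology} hardy \<Rightarrow> 'a hardy" where
  "mult_tensor h X F = abs_hardy (\<lambda>z. h z *\<^sub>C X (rep_hardy F z))"

abbreviation id_tensor (\<open>I\<otimes>_\<close> [1000] 1000) where "I\<otimes>X \<equiv> mult_tensor (\<lambda>_. 1) X"
abbreviation shift_tensor (\<open>S\<^sub>z\<otimes>_\<close> [1000] 1000) where "S\<^sub>z\<otimes>X \<equiv> mult_tensor (\<lambda>z. z) X"

lemma rep_abs_hardy:
  assumes f: "f \<in> hardy_functions"
  shows "AE z in circle_measure. rep_hardy (abs_hardy f) z = f z"
  using Quotient3_rep_abs[OF Quotient3_hardy, of f] f by (simp add: hardy_rel_def)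

lemma rep_hardy_functions: "rep_hardy F \<in> hardy_functions"
  using Quotient3_rep_reflp[OF Quotient3_hardy, of F] by (simp add: hardy_rel_def)

lemma mult_tensor_id:
  assumes X: "bounded_clinear X" and f: "f \<in> hardy_functions"
  shows "(\<lambda>z. X (f z)) \<in> hardy_functions" "(I\<otimes>X) (abs_hardy f) = abs_hardy (\<lambda>z. X (f z))"
proof -
  have one: "1 *\<^sub>C x = x" for x :: 'a using scaleC_of_real[of 1 x] by simp
  show m: "(\<lambda>z. X (f z)) \<in> hardy_functions" by (rule hardy_bounded_clinear[OF X f])
  have "hardy_rel (\<lambda>z. X (rep_hardy (abs_hardy f) z)) (\<lambda>z. X (f z))"
    using rep_abs_hardy[OF f] m hardy_bounded_clinear[OF X rep_hardy_functions]
    by (auto simp: hardy_rel_def)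
  then show "(I\<otimes>X) (abs_hardy f) = abs_hardy (\<lambda>z. X (f z))"
    by (simp add: mult_tensor_def one Quotient3_rel_abs[OF Quotient3_hardy])
qed

lemma mult_tensor_shift:
  assumes X: "bounded_clinear X" and f: "f \<in> hardy_functions"
  shows "(\<lambda>z. z *\<^sub>C X (f z)) \<in> hardy_functions"
    "(S\<^sub>z\<otimes>X) (abs_hardy f) = abs_hardy (\<lambda>z. z *\<^sub>C X (f z))"
proof -
  show m: "(\<lambda>z. z *\<^sub>C X (f z)) \<in> hardy_functions"
    by (rule hardy_shift[OF hardy_bounded_clinear[OF X f]])
  have "hardy_rel (\<lambda>z. z *\<^sub>C X (rep_hardy (abs_hardy f) z)) (\<lambda>z. z *\<^sub>C X (f z))"
    using rep_abs_hardy[OF f] m hardy_shift[OF hardy_bounded_clinear[OF X rep_hardy_functions]]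
    by (auto simp: hardy_rel_def)
  then show "(S\<^sub>z\<otimes>X) (abs_hardy f) = abs_hardy (\<lambda>z. z *\<^sub>C X (f z))"
    by (simp add: mult_tensor_def Quotient3_rel_abs[OF Quotient3_hardy])
qed


section \<open>BCL triples and pairs\<close>

text \<open>The Hilbert space of the triple is the type \<^typ>\<open>'a\<close>; its separability is the sort
  constraint \<^class>\<open>second_countable_topology\<close>.\<close>

definition BCL_triple ::
  "('a::{complex_hilbert,second_countable_topology} \<Rightarrow> 'a) \<Rightarrow> ('a \<Rightarrow> 'a) \<Rightarrow> bool" where
  "BCL_triple U P \<longleftrightarrow> unitary_op U \<and> orthogonal_projection_op P"

definition perp :: "('a::complex_inner \<Rightarrow> 'a) \<Rightarrow> 'a \<Rightarrow> 'a" where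
  "perp P = (\<lambda>x. x - P x)"

definition BCL1 ::
  "('a::{complex_hilbert,second_countable_topology} \<Rightarrow> 'a) \<Rightarrow> ('a \<Rightarrow> 'a) \<Rightarrow> 'a hardy \<Rightarrow> 'a hardy" where
  "BCL1 U P F = (I\<otimes>(P \<circ> cadjoint U)) F + (S\<^sub>z\<otimes>(perp P \<circ> cadjoint U)) F"

definition BCL2 ::
  "('a::{complex_hilbert,second_countable_topology} \<Rightarrow> 'a) \<Rightarrow> ('a \<Rightarrow> 'a) \<Rightarrow> 'a hardy \<Rightarrow> 'a hardy" where
  "BCL2 U P F = (I\<otimes>(U \<circ> perp P)) F + (S\<^sub>z\<otimes>(U \<circ> P)) F"

end

theory Submission
  imports Defs
begin

text \<open>Let \<open>S\<^sub>z\<^sup>*\<close> be the backward shift and \<open>F\<^sub>0, F\<^sub>1\<close> the first two Fourier coefficients of \<open>F\<close>.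
  Both products of the adjoints of the BCL pair equal \<open>S\<^sub>z\<^sup>*\<close>, and \<open>\<parallel>F\<parallel>\<^sup>2 - \<parallel>V\<^sup>*F\<parallel>\<^sup>2\<close> depends only on
  \<open>F\<^sub>0\<close> for \<open>V\<close> either member of the pair or \<open>S\<^sub>z\<close>. Hence
  \<open>\<langle>HF, F\<rangle> = \<parallel>PU\<^sup>*(P\<^sup>\<bottom>U\<^sup>*F\<^sub>0 + PU\<^sup>*F\<^sub>1)\<parallel>\<^sup>2 - \<parallel>PF\<^sub>0\<parallel>\<^sup>2\<close>, with \<open>F\<^sub>0\<close> and \<open>F\<^sub>1\<close> arbitrary.
  Since \<open>\<langle>Ds, s\<rangle> = \<parallel>PU\<^sup>*PU\<^sup>*s\<parallel>\<^sup>2\<close>, the condition \<open>D \<le> 0\<close> means \<open>PU\<^sup>*PU\<^sup>* = 0\<close>; then \<open>B = D = 0\<close>, the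
  Cauchy--Schwarz condition is void, and the form reduces to \<open>\<langle>AF\<^sub>0, F\<^sub>0\<rangle>\<close>.\<close>


section \<open>Fourier coefficients on the circle\<close>

lemma AE_circle_nonzero: "AE z in circle_measure. z \<noteq> 0"
  using AE_circle_measure by eventually_elim auto

text \<open>\<open>mult_tensor\<close> is defined through the chosen representative
  \<open>rep_hardy\<close>. Writing each class as \<open>abs_hardy f\<close> allows any
  representative, so operator identities reduce to pointwise computations almost everywhere.\<close>

lemma hardy_cases: obtains f where "f \<in> hardy_functions" "F = abs_hardy f"
  using rep_hardy_functions Quotient3_abs_rep[OF Quotient3_hardy] by metis

lemma abs_hardy_eqI:
  assumes "f \<in> hardy_functions" "g \<in> hardy_functions" "AE z in circle_measure. f z = g z"
  shows "abs_hardy f = abs_hardy g"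
  using assms by (simp add: Quotient3_rel_abs[OF Quotient3_hardy] hardy_rel_def)

lemma abs_hardy_add:
  assumes "f \<in> hardy_functions" "g \<in> hardy_functions"
  shows "abs_hardy f + abs_hardy g = abs_hardy (\<lambda>z. f z + g z)"
  using assms by (simp add: plus_hardy.abs_eq hardy_rel_def)

lemma cinner_abs_hardy:
  assumes "f \<in> hardy_functions" "g \<in> hardy_functions"
  shows "cinner (abs_hardy f) (abs_hardy g) = (\<integral>z. cinner (f z) (g z) \<partial>circle_measure)"
  using assms by (simp add: cinner_hardy.abs_eq hardy_rel_def)

lemma fourier_coeff_add:
  assumes f: "f \<in> hardy_functions" and g: "g \<in> hardy_functions"
  shows "fourier_coeff (\<lambda>z. f z + g z) n = fourier_coeff f n + fourier_coeff g n"
  using integrable_fourier[OF hardy_functionsD(1,2)[OF f], of "-n"]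
      integrable_fourier[OF hardy_functionsD(1,2)[OF g], of "-n"]
  by (simp add: fourier_coeff_def scaleC_add_right)

lemma fourier_coeff_bounded_clinear:
  assumes T: "bounded_clinear T" and f: "f \<in> hardy_functions"
  shows "fourier_coeff (\<lambda>z. T (f z)) n = T (fourier_coeff f n)"
proof -
  have bl: "bounded_linear T" and sc: "\<And>c x. T (c *\<^sub>C x) = c *\<^sub>C T x"
    using T by (auto simp: bounded_clinear_def)
  show ?thesis
    unfolding fourier_coeff_def sc[symmetric]
    by (rule integral_bounded_linear[OF bl integrable_fourier[OF hardy_functionsD(1,2)[OF f]]])
qed

lemma fourier_coeff_cong_AE:
  assumes [measurable]: "f \<in> borel_measurable circle_measure" "g \<in> borel_measurable circle_measure"
    and "AE z in circle_measure. f z = g z"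
  shows "fourier_coeff f n = fourier_coeff g n"
  unfolding fourier_coeff_def by (rule integral_cong_AE) (use assms(3) in auto)

lemma fourier_coeff_powi:
  fixes f :: "complex \<Rightarrow> 'a::{complex_hilbert,second_countable_topology}"
  assumes [measurable]: "f \<in> borel_measurable circle_measure"
  shows "fourier_coeff (\<lambda>z. (z powi k) *\<^sub>C f z) n = fourier_coeff f (n - k)"
  unfolding fourier_coeff_def
proof (rule integral_cong_AE)
  show "AE z in circle_measure. (z powi (- n)) *\<^sub>C (z powi k) *\<^sub>C f z = (z powi (- (n - k))) *\<^sub>C f z"
    using AE_circle_measure
  proof eventually_elim
    case (elim z)
    \<comment> \<open>The exponent law for \<open>powi\<close> with integer exponents requires a
      nonzero base; almost every point lies on the circle.\<close>
    then have "z \<noteq> 0" by auto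
    then have "z powi (- n) * z powi k = z powi (- (n - k))"
      by (simp add: power_int_add[symmetric])
    then show ?case by (simp add: scaleC_scaleC)
  qed
qed measurable

lemma scaleC_one: "1 *\<^sub>C x = (x::'a::complex_inner)"
  using scaleC_of_real[of 1 x] by simp

lemma measure_circle_measure: "measure circle_measure UNIV = 1"
  by (simp add: measure_def emeasure_circle_measure)

lemma space_circle_measure: "space circle_measure = UNIV"
  by (simp add: circle_measure_def)

lemma fourier_coeff_const_0: "fourier_coeff (\<lambda>_. a) 0 = a"
  by (simp add: fourier_coeff_def scaleC_one measure_circle_measure space_circle_measure)

text \<open>Orthogonality of the characters of the circle: after pulling back along
  \<open>cis\<close>, the integrand has the periodic antiderivative \<open>?F\<close>, which is
  defined because \<open>m\<close> is nonzero.\<close>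

lemma integral_powi_circle_measure:
  assumes "m \<noteq> 0"
  shows "(\<integral>z. z powi m \<partial>circle_measure) = 0"
proof -
  let ?I = "{0..<2*pi::real}"
  let ?F = "\<lambda>t. cis (of_int m * t) / (\<i> * of_int m)"
  have "(\<integral>z. z powi m \<partial>circle_measure) = (\<integral>t. cis t powi m \<partial>uniform_measure lborel ?I)"
    unfolding circle_measure_def by (rule integral_distr) auto
  also have "uniform_measure lborel ?I = density lborel (\<lambda>t. ennreal (indicator ?I t / (2*pi)))"
    unfolding uniform_measure_def
    by (rule density_cong) (auto simp: indicator_def divide_ennreal[symmetric])
  also have "(\<integral>t. cis t powi m \<partial>\<dots>) = (\<integral>t. (indicator ?I t / (2*pi)) *\<^sub>R cis t powi m \<partial>lborel)"
    by (rule integral_density) auto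
  also have "\<dots> = (\<integral>t. (1 / (2*pi)) *\<^sub>R (indicator {0..2*pi} t *\<^sub>R cis (of_int m * t)) \<partial>lborel)"
  proof (rule integral_cong_AE)
    show "AE t in lborel. (indicator ?I t / (2*pi)) *\<^sub>R cis t powi m
        = (1 / (2*pi)) *\<^sub>R (indicator {0..2*pi} t *\<^sub>R cis (of_int m * t))"
      \<comment> \<open>The half-open and the closed interval differ only in the null set consisting
        of \<open>2*pi\<close>; the closed one suits the fundamental theorem of calculus.\<close>
      using AE_lborel_singleton[of "2*pi"]
      by eventually_elim (auto simp: indicator_def cis_power_int)
  qed measurable
  also have "\<dots> = (1 / (2*pi)) *\<^sub>R (\<integral>t. indicator {0..2*pi} t *\<^sub>R cis (of_int m * t) \<partial>lborel)"
    by (rule integral_scaleR_right)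
  also have "(\<integral>t. indicator {0..2*pi} t *\<^sub>R cis (of_int m * t) \<partial>lborel) = ?F (2*pi) - ?F 0"
  proof (rule has_bochner_integral_integral_eq[OF has_bochner_integral_FTC_Icc])
    show "continuous_on {0..2*pi} (\<lambda>t. cis (of_int m * t))" by (intro continuous_intros)
    show "(?F has_vector_derivative cis (of_int m * t)) (at t within {0..2*pi})" for t
      using assms
      by (auto intro!: derivative_eq_intros simp: has_vector_derivative_def fun_eq_iff field_simps scaleR_conv_of_real)
  qed simp
  also have "?F (2*pi) - ?F 0 = 0"
    using cis_multiple_2pi[of "of_int m"] by (simp add: ac_simps)
  finally show ?thesis by simp
qed

lemma hardy_const: "(\<lambda>_. a) \<in> hardy_functions"
proof -
  have "fourier_coeff (\<lambda>_. a) n = 0" if "n < 0" for n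
  proof -
    have int: "integrable circle_measure (\<lambda>z. z powi (- n))"
      using integrable_fourier[of "\<lambda>_. 1::complex" "- n"] by (simp add: scaleC_complex_def)
    show ?thesis
      \<comment> \<open>The coefficient is a scalar integral of a nontrivial character, multiplied
        by the vector \<open>a\<close>.\<close>
      using integral_bounded_linear[OF bounded_bilinear.bounded_linear_left[OF bounded_bilinear_scaleC] int, of a]
        integral_powi_circle_measure[of "- n"] that
      by (simp add: fourier_coeff_def bounded_bilinear.zero_left[OF bounded_bilinear_scaleC])
  qed
  then show ?thesis by (simp add: hardy_functions_def)
qed

lemma bounded_clinear_ident: "bounded_clinear (\<lambda>x. x)"
  unfolding bounded_clinear_def by (simp add: bounded_linear_ident)

lemma bounded_clinear_compose:
  "bounded_clinear S \<Longrightarrow> bounded_clinear T \<Longrightarrow> bounded_clinear (S \<circ> T)"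
  unfolding bounded_clinear_def o_def by (simp add: bounded_linear_compose[of S T])

lemma fourier_coeff_diff_const:
  assumes f: "f \<in> hardy_functions"
  shows "fourier_coeff (\<lambda>z. f z - a) n = fourier_coeff f n - fourier_coeff (\<lambda>_. a) n"
proof -
  have "- 1 *\<^sub>C x = - x" for x :: 'a
    using scaleC_of_real[of "- 1" x] by simp
  then show ?thesis
    using fourier_coeff_add[OF f hardy_const[of "- a"], of n]
      fourier_coeff_bounded_clinear[OF bounded_clinear_scaleC[of "- 1"] hardy_const[of a], of n]
    by simp
qed

section \<open>The backward shift\<close>

text \<open>Division by z lowers every index by one. Only index -1 is critical: there the old
  coefficient of index 0 arrives, and it was subtracted beforehand.\<close>

lemma hardy_bshift:
  assumes f: "f \<in> hardy_functions"
  shows "(\<lambda>z. z powi (- 1) *\<^sub>C (f z - fourier_coeff f 0)) \<in> hardy_functions"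
proof -
  let ?g = "\<lambda>z. f z - fourier_coeff f 0"
  have g: "?g \<in> hardy_functions"
    using hardy_add[OF f hardy_const[of "- fourier_coeff f 0"]] by simp
  note [measurable] = hardy_functionsD(1)[OF f] hardy_functionsD(1)[OF g]
  have "integrable circle_measure (\<lambda>z. (norm (z powi (- 1) *\<^sub>C ?g z))\<^sup>2)"
    by (rule Bochner_Integration.integrable_bound[OF hardy_functionsD(2)[OF g]])
       (use AE_circle_measure in \<open>auto simp: norm_scaleC norm_inverse elim!: eventually_mono\<close>)
  moreover have "fourier_coeff (\<lambda>z. z powi (- 1) *\<^sub>C ?g z) n = 0" if "n < 0" for n
  proof (cases "n = - 1")
    case True
    then show ?thesis
      by (simp only: fourier_coeff_powi[OF hardy_functionsD(1)[OF g]])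
         (simp add: fourier_coeff_diff_const[OF f] fourier_coeff_const_0)
  next
    case False
    with that have "n - (- 1) < 0" by simp
    then show ?thesis
      by (simp only: fourier_coeff_powi[OF hardy_functionsD(1)[OF g]] hardy_functionsD(3)[OF g])
  qed
  ultimately show ?thesis by (simp add: hardy_functions_def)
qed

lift_definition const_coeff :: "'a::{complex_hilbert,second_countable_topology} hardy \<Rightarrow> 'a"
  is "\<lambda>f. fourier_coeff f 0"
  by (auto simp: hardy_rel_def hardy_functionsD intro!: fourier_coeff_cong_AE)

text \<open>On functions this is (f(z) - f_0) / z, the adjoint of the shift; adjointness is proved
  in \<open>cinner_forward_shift_left\<close>.\<close>

lift_definition backward_shift ::
  "'a::{complex_hilbert,second_countable_topology} hardy \<Rightarrow> 'a hardy"
  is "\<lambda>f z. z powi (- 1) *\<^sub>C (f z - fourier_coeff f 0)"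
proof -
  fix f g :: "complex \<Rightarrow> 'a"
  assume "hardy_rel f g"
  moreover from this have "fourier_coeff f 0 = fourier_coeff g 0"
    by (auto simp: hardy_rel_def hardy_functionsD intro!: fourier_coeff_cong_AE)
  ultimately show "hardy_rel (\<lambda>z. z powi (- 1) *\<^sub>C (f z - fourier_coeff f 0))
      (\<lambda>z. z powi (- 1) *\<^sub>C (g z - fourier_coeff g 0))"
    using hardy_bshift[of f] hardy_bshift[of g] by (auto simp: hardy_rel_def)
qed

definition const_hardy :: "'a::{complex_hilbert,second_countable_topology} \<Rightarrow> 'a hardy" where
  "const_hardy a = abs_hardy (\<lambda>_. a)"

abbreviation forward_shift :: "'a::{complex_hilbert,second_countable_topology} hardy \<Rightarrow> 'a hardy" where
  "forward_shift \<equiv> S\<^sub>z\<otimes>(\<lambda>x. x)"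

lemma const_coeff_abs_hardy:
  "f \<in> hardy_functions \<Longrightarrow> const_coeff (abs_hardy f) = fourier_coeff f 0"
  by (simp add: const_coeff.abs_eq hardy_rel_def)

lemma backward_shift_abs_hardy:
  "f \<in> hardy_functions \<Longrightarrow>
    backward_shift (abs_hardy f) = abs_hardy (\<lambda>z. z powi (- 1) *\<^sub>C (f z - fourier_coeff f 0))"
  by (simp add: backward_shift.abs_eq hardy_rel_def)

lemmas forward_shift_abs_hardy = mult_tensor_shift(2)[OF bounded_clinear_ident]

text \<open>Splitting off the shift reduces all operators to two kinds, \<open>forward_shift\<close>
  and operators \<open>I\<otimes>T\<close>, whose adjoints are found separately.\<close>

lemma shift_tensor_eq:
  assumes "bounded_clinear T"
  shows "(S\<^sub>z\<otimes>T) F = forward_shift ((I\<otimes>T) F)"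
proof -
  obtain f where "f \<in> hardy_functions" "F = abs_hardy f" by (rule hardy_cases)
  then show ?thesis
    using assms by (simp add: mult_tensor_shift mult_tensor_id forward_shift_abs_hardy)
qed

text \<open>The Wold-type splitting into the range of the shift and the constants. It replaces work
  with representatives in most of what follows.\<close>

lemma forward_backward_shift: "forward_shift (backward_shift F) + const_hardy (const_coeff F) = F"
proof -
  obtain f where f: "f \<in> hardy_functions" "F = abs_hardy f" by (rule hardy_cases)
  show ?thesis
    unfolding f(2) const_hardy_def backward_shift_abs_hardy[OF f(1)] const_coeff_abs_hardy[OF f(1)]
      forward_shift_abs_hardy[OF hardy_bshift[OF f(1)]]
      abs_hardy_add[OF hardy_shift[OF hardy_bshift[OF f(1)]] hardy_const]
  proof (rule abs_hardy_eqI[OF hardy_add[OF hardy_shift[OF hardy_bshift[OF f(1)]] hardy_const] f(1)])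
    show "AE z in circle_measure.
        z *\<^sub>C z powi (- 1) *\<^sub>C (f z - fourier_coeff f 0) + fourier_coeff f 0 = f z"
      using AE_circle_nonzero
      by eventually_elim (simp add: scaleC_scaleC scaleC_one power_int_minus)
  qed
qed

lemma fourier_coeff_shift:
  assumes "f \<in> hardy_functions"
  shows "fourier_coeff (\<lambda>z. z *\<^sub>C f z) n = fourier_coeff f (n - 1)"
  using fourier_coeff_powi[OF hardy_functionsD(1)[OF assms], of 1 n] by simp

lemma const_coeff_forward_shift: "const_coeff (forward_shift F) = 0"
proof -
  obtain f where f: "f \<in> hardy_functions" "F = abs_hardy f" by (rule hardy_cases)
  then show ?thesis
    by (simp add: forward_shift_abs_hardy const_coeff_abs_hardy hardy_shift fourier_coeff_shift
        hardy_functionsD)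
qed

lemma backward_forward_shift: "backward_shift (forward_shift F) = F"
proof -
  obtain f where f: "f \<in> hardy_functions" "F = abs_hardy f" by (rule hardy_cases)
  \<comment> \<open>This is the coefficient of \<open>f\<close> at index -1, which vanishes in the
    Hardy space.\<close>
  have s: "fourier_coeff (\<lambda>z. z *\<^sub>C f z) 0 = 0"
    by (simp add: fourier_coeff_shift f hardy_functionsD)
  show ?thesis
    unfolding f(2) forward_shift_abs_hardy[OF f(1)] backward_shift_abs_hardy[OF hardy_shift[OF f(1)]]
  proof (rule abs_hardy_eqI[OF hardy_bshift[OF hardy_shift[OF f(1)]] f(1)])
    show "AE z in circle_measure.
        z powi (- 1) *\<^sub>C (z *\<^sub>C f z - fourier_coeff (\<lambda>z. z *\<^sub>C f z) 0) = f z"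
      unfolding s using AE_circle_nonzero
      by eventually_elim (simp add: scaleC_scaleC scaleC_one power_int_minus)
  qed
qed

lemma const_coeff_const_hardy: "const_coeff (const_hardy a) = a"
  by (simp add: const_hardy_def const_coeff_abs_hardy hardy_const fourier_coeff_const_0)

lemma const_coeff_add: "const_coeff (F + G) = const_coeff F + const_coeff G"
proof -
  obtain f where f: "f \<in> hardy_functions" "F = abs_hardy f" by (rule hardy_cases)
  obtain g where g: "g \<in> hardy_functions" "G = abs_hardy g" by (rule hardy_cases)
  with f show ?thesis
    by (simp add: abs_hardy_add const_coeff_abs_hardy hardy_add fourier_coeff_add)
qed

lemma forward_shift_add: "forward_shift (F + G) = forward_shift F + forward_shift G"
proof -
  obtain f where f: "f \<in> hardy_functions" "F = abs_hardy f" by (rule hardy_cases)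
  obtain g where g: "g \<in> hardy_functions" "G = abs_hardy g" by (rule hardy_cases)
  with f show ?thesis
    by (simp add: abs_hardy_add forward_shift_abs_hardy hardy_add hardy_shift scaleC_add_right)
qed

lemma const_hardy_add: "const_hardy (a + b) = const_hardy a + const_hardy b"
  by (simp add: const_hardy_def abs_hardy_add hardy_const)

lemma forward_shift_eqD:
  assumes "forward_shift F = forward_shift G" shows "F = G"
  by (metis assms backward_forward_shift)

text \<open>The shift is injective, so it suffices to compare the splittings of both sides after
  cancelling the constants.\<close>

lemma backward_shift_add: "backward_shift (F + G) = backward_shift F + backward_shift G"
proof (rule forward_shift_eqD)
  have "forward_shift (backward_shift (F + G)) + const_hardy (const_coeff (F + G))
      = (forward_shift (backward_shift F) + const_hardy (const_coeff F))
        + (forward_shift (backward_shift G) + const_hardy (const_coeff G))"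
    by (simp only: forward_backward_shift)
  then show "forward_shift (backward_shift (F + G)) = forward_shift (backward_shift F + backward_shift G)"
    by (simp add: const_coeff_add const_hardy_add forward_shift_add)
qed

lemma cinner_forward_shift: "cinner (forward_shift F) (forward_shift G) = cinner F G"
proof -
  obtain f where f: "f \<in> hardy_functions" "F = abs_hardy f" by (rule hardy_cases)
  obtain g where g: "g \<in> hardy_functions" "G = abs_hardy g" by (rule hardy_cases)
  note [measurable] = hardy_functionsD(1)[OF f(1)] hardy_functionsD(1)[OF g(1)]
  have "(\<integral>z. cinner (z *\<^sub>C f z) (z *\<^sub>C g z) \<partial>circle_measure) = (\<integral>z. cinner (f z) (g z) \<partial>circle_measure)"
  proof (rule integral_cong_AE)
    show "AE z in circle_measure. cinner (z *\<^sub>C f z) (z *\<^sub>C g z) = cinner (f z) (g z)"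
      using AE_circle_measure
    proof eventually_elim
      case (elim z)
      then have "cnj z * z = 1" using complex_norm_square[of z] by (simp add: mult.commute)
      then show ?case
        by (simp add: cinner_scaleC_left cinner_scaleC_right mult.assoc[symmetric])
    qed
  qed measurable
  then show ?thesis
    by (simp add: f g forward_shift_abs_hardy cinner_abs_hardy hardy_shift)
qed

text \<open>Embedding constants is adjoint to taking the constant coefficient; hence constants are
  orthogonal to the range of the shift.\<close>

lemma cinner_const_hardy: "cinner F (const_hardy a) = cinner (const_coeff F) a"
proof -
  obtain f where f: "f \<in> hardy_functions" "F = abs_hardy f" by (rule hardy_cases)
  have int: "integrable circle_measure f"
    using integrable_fourier[OF hardy_functionsD(1,2)[OF f(1)], of 0] by (simp add: scaleC_one)
  show ?thesis
    using integral_bounded_linear[OF bounded_bilinear.bounded_linear_left[OF bounded_bilinear_cinner] int, of a]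
    by (simp add: f const_hardy_def cinner_abs_hardy hardy_const const_coeff_abs_hardy fourier_coeff_def scaleC_one)
qed

lemma cinner_forward_shift_left: "cinner (forward_shift F) G = cinner F (backward_shift G)"
proof -
  have "cinner (forward_shift F) G
      = cinner (forward_shift F) (forward_shift (backward_shift G) + const_hardy (const_coeff G))"
    by (simp only: forward_backward_shift)
  then show ?thesis
    by (simp add: cinner_add_right cinner_forward_shift cinner_const_hardy const_coeff_forward_shift
        bounded_bilinear.zero_left[OF bounded_bilinear_cinner])
qed

text \<open>Pythagoras for the splitting of \<open>F\<close> into a shifted part and a constant.
  This is the source of every dependence on the constant coefficient below.\<close>

lemma cinner_backward_shift_self:
  "cinner (backward_shift F) (backward_shift F) = cinner F F - cinner (const_coeff F) (const_coeff F)"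
proof -
  have "cinner F F = cinner (forward_shift (backward_shift F) + const_hardy (const_coeff F)) F"
    by (simp only: forward_backward_shift)
  also have "\<dots> = cinner (backward_shift F) (backward_shift F) + cnj (cinner F (const_hardy (const_coeff F)))"
    by (simp add: cinner_add_left cinner_forward_shift_left cinner_commute[symmetric])
  also have "cnj (cinner F (const_hardy (const_coeff F))) = cinner (const_coeff F) (const_coeff F)"
    by (simp add: cinner_const_hardy cinner_commute[symmetric])
  finally show ?thesis by simp
qed

section \<open>Operators acting on the values of Hardy functions\<close>

lemma bounded_clinear_apply_add: "bounded_clinear T \<Longrightarrow> T (x + y) = T x + T y"
  unfolding bounded_clinear_def by (metis linear_simps(1))

lemma id_tensor_add:
  assumes "bounded_clinear T"
  shows "(I\<otimes>T) (F + G) = (I\<otimes>T) F + (I\<otimes>T) G"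
proof -
  obtain f where f: "f \<in> hardy_functions" "F = abs_hardy f" by (rule hardy_cases)
  obtain g where g: "g \<in> hardy_functions" "G = abs_hardy g" by (rule hardy_cases)
  with f show ?thesis
    using assms
    by (simp add: abs_hardy_add mult_tensor_id hardy_add bounded_clinear_apply_add)
qed

lemma id_tensor_compose:
  assumes "bounded_clinear S" "bounded_clinear T"
  shows "(I\<otimes>(S \<circ> T)) F = (I\<otimes>S) ((I\<otimes>T) F)"
proof -
  obtain f where "f \<in> hardy_functions" "F = abs_hardy f" by (rule hardy_cases)
  then show ?thesis
    using assms by (simp add: mult_tensor_id mult_tensor_id(2)[OF bounded_clinear_compose])
qed

lemma id_tensor_ident: "(I\<otimes>(\<lambda>x. x)) F = F"
proof -
  obtain f where "f \<in> hardy_functions" "F = abs_hardy f" by (rule hardy_cases)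
  then show ?thesis by (simp add: mult_tensor_id bounded_clinear_ident)
qed

lemma cinner_id_tensor_left:
  assumes "bounded_clinear T" "bounded_clinear T'" "\<And>x y. cinner (T x) y = cinner x (T' y)"
  shows "cinner ((I\<otimes>T) F) G = cinner F ((I\<otimes>T') G)"
proof -
  obtain f where f: "f \<in> hardy_functions" "F = abs_hardy f" by (rule hardy_cases)
  obtain g where g: "g \<in> hardy_functions" "G = abs_hardy g" by (rule hardy_cases)
  with f show ?thesis
    using assms by (simp add: mult_tensor_id cinner_abs_hardy)
qed

lemma const_coeff_id_tensor:
  assumes "bounded_clinear T"
  shows "const_coeff ((I\<otimes>T) F) = T (const_coeff F)"
proof -
  obtain f where "f \<in> hardy_functions" "F = abs_hardy f" by (rule hardy_cases)
  then show ?thesis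
    using assms by (simp add: mult_tensor_id const_coeff_abs_hardy fourier_coeff_bounded_clinear)
qed

text \<open>A bounded linear \<open>T\<close> commutes both with multiplication by a scalar function
  and with taking Fourier coefficients.\<close>

lemma id_tensor_backward_shift:
  assumes T: "bounded_clinear T"
  shows "(I\<otimes>T) (backward_shift F) = backward_shift ((I\<otimes>T) F)"
proof -
  obtain f where f: "f \<in> hardy_functions" "F = abs_hardy f" by (rule hardy_cases)
  have "T (z powi (- 1) *\<^sub>C (f z - fourier_coeff f 0)) = z powi (- 1) *\<^sub>C (T (f z) - T (fourier_coeff f 0))" for z
    using T unfolding bounded_clinear_def by (metis linear_simps(2))
  then show ?thesis
    using f T by (simp only: backward_shift_abs_hardy mult_tensor_id hardy_bshift fourier_coeff_bounded_clinear)
qed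

lemma cinner_zero_left: "cinner 0 (x::'a::complex_inner) = 0"
  by (rule bounded_bilinear.zero_left[OF bounded_bilinear_cinner])

lemma cinner_diff_left: "cinner (x - y) (z::'a::complex_inner) = cinner x z - cinner y z"
  by (rule bounded_bilinear.diff_left[OF bounded_bilinear_cinner])

lemma backward_shift_zero: "backward_shift 0 = 0"
  using backward_shift_add[of 0 0] by simp

lemma bounded_clinear_zero: "bounded_clinear T \<Longrightarrow> T 0 = 0"
  unfolding bounded_clinear_def by (simp add: linear_simps(3))

lemma backward_shift_const_hardy: "backward_shift (const_hardy a) = 0"
proof (rule forward_shift_eqD)
  have "forward_shift 0 = (0 :: 'a hardy)"
    using forward_shift_add[of 0 "0 :: 'a hardy"] by simp
  then show "forward_shift (backward_shift (const_hardy a)) = forward_shift 0"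
    using forward_backward_shift[of "const_hardy a"] by (simp add: const_coeff_const_hardy)
qed

lemma id_tensor_zero: "bounded_clinear T \<Longrightarrow> (I\<otimes>T) 0 = 0"
  using id_tensor_add[of T 0 0] by simp

section \<open>The BCL pair\<close>

text \<open>A surjective isometry is bijective and its inverse satisfies the adjoint equation, so
  \<open>cadjoint_unique\<close> identifies the chosen \<open>cadjoint U\<close> with
  \<open>inv U\<close>.\<close>

lemma unitary_op_cadjoint:
  assumes "unitary_op U"
  shows "U (cadjoint U x) = x" "cadjoint U (U x) = x"
    "cinner (U x) y = cinner x (cadjoint U y)" "bounded_clinear (cadjoint U)"
proof -
  have U: "bounded_clinear U" "surj U" and iso: "cinner (U x) (U y) = cinner x y" for x y
    using assms by (auto simp: unitary_op_def)
  have lin: "U (x + y) = U x + U y" "U (c *\<^sub>C x) = c *\<^sub>C U x" for x y c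
    using U(1) by (auto simp: bounded_clinear_def linear_simps(1))
  have inv: "U (inv U x) = x" for x
    by (rule surj_f_inv_f[OF U(2)])
  have adj: "cinner (U x) y = cinner x (inv U y)" for x y
    using iso[of x "inv U y"] by (simp add: inv)
  have eq: "cadjoint U = inv U"
    by (rule cadjoint_unique) (rule adj)
  have norm: "norm (U x) = norm x" for x
    using iso[of x x] by (simp add: norm_eq_sqrt_inner Re_cinner[symmetric])
  have "inj U"
  proof (rule injI)
    fix x y assume "U x = U y"
    \<comment> \<open>The difference is written with the scalar -1 so that \<open>lin\<close>
      applies.\<close>
    then have "norm (U (x + (-1) *\<^sub>C y)) = 0"
      using scaleC_of_real[of "-1" "U y"] by (simp add: lin)
    then show "x = y"
      using scaleC_of_real[of "-1" y] by (simp add: norm)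
  qed
  then have inv': "inv U (U x) = x" for x
    by (rule inv_f_f)
  show "U (cadjoint U x) = x" "cadjoint U (U x) = x" "cinner (U x) y = cinner x (cadjoint U y)"
    by (simp_all add: eq inv inv' adj)
  have add: "inv U (x + y) = inv U x + inv U y" for x y
    by (metis inv inv' lin(1))
  have sc: "inv U (c *\<^sub>C x) = c *\<^sub>C inv U x" for c x
    by (metis inv inv' lin(2))
  have "bounded_linear (inv U)"
  proof (rule bounded_linear_intro[where K = 1])
    show "inv U (r *\<^sub>R x) = r *\<^sub>R inv U x" for r x
      by (metis sc scaleC_of_real)
    show "norm (inv U x) \<le> norm x * 1" for x
      by (metis norm inv order_refl mult.right_neutral)
  qed (rule add)
  then show "bounded_clinear (cadjoint U)"
    by (simp add: bounded_clinear_def eq sc)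
qed

lemma bounded_clinear_perp:
  assumes "bounded_clinear P"
  shows "bounded_clinear (perp P)"
proof -
  have "c *\<^sub>C (x - y) = c *\<^sub>C x - c *\<^sub>C y" for c and x y :: 'a
    by (rule bounded_bilinear.diff_right[OF bounded_bilinear_scaleC])
  then show ?thesis
    using assms unfolding bounded_clinear_def perp_def
    by (simp add: bounded_linear_sub bounded_linear_ident)
qed

locale bcl_triple =
  fixes U P :: "'s::{complex_hilbert,second_countable_topology} \<Rightarrow> 's"
  assumes BCL_triple: "BCL_triple U P"
begin

lemma unitary: "unitary_op U" and projection: "orthogonal_projection_op P"
  using BCL_triple by (auto simp: BCL_triple_def)

lemma bounded [simp]:
  "bounded_clinear U" "bounded_clinear P" "bounded_clinear (perp P)" "bounded_clinear (cadjoint U)"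
  using unitary projection unitary_op_cadjoint(4)[OF unitary] bounded_clinear_perp
  by (auto simp: unitary_op_def orthogonal_projection_op_def)

lemma P_idem: "P (P x) = P x"
  using projection by (metis orthogonal_projection_op_def comp_apply)

lemma cinner_P: "cinner (P x) y = cinner x (P y)"
  using projection by (simp add: orthogonal_projection_op_def)

lemma cinner_perp: "cinner (perp P x) y = cinner x (perp P y)"
  using bounded_bilinear.diff_left[OF bounded_bilinear_cinner, of x "P x" y]
    bounded_bilinear.diff_right[OF bounded_bilinear_cinner, of x y "P y"]
  by (simp add: perp_def cinner_P)

lemma cinner_U: "cinner (U x) y = cinner x (cadjoint U y)"
  by (rule unitary_op_cadjoint(3)[OF unitary])

lemma cinner_cadjoint_U: "cinner (cadjoint U x) y = cinner x (U y)"
  by (metis cinner_U cinner_commute)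

lemma cinner_P_self: "cinner (P x) (P x) = cinner (P x) x"
  by (metis P_idem cinner_P)

lemma cinner_perp_self: "cinner (perp P x) (perp P x) = cinner x x - cinner (P x) (P x)"
proof -
  have "perp P (perp P x) = perp P x"
    using P_idem bounded(2) unfolding perp_def bounded_clinear_def
    by (simp add: linear_simps(2))
  then have "cinner (perp P x) (perp P x) = cinner (perp P x) x"
    by (metis cinner_perp)
  then show ?thesis
    by (simp add: perp_def cinner_diff_left cinner_P_self)
qed

lemma tensor_U: "(I\<otimes>U) ((I\<otimes>(cadjoint U)) F) = F" "(I\<otimes>(cadjoint U)) ((I\<otimes>U) F) = F"
proof -
  have "U \<circ> cadjoint U = (\<lambda>x. x)" "cadjoint U \<circ> U = (\<lambda>x. x)"
    by (auto simp: unitary_op_cadjoint[OF unitary])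
  then show "(I\<otimes>U) ((I\<otimes>(cadjoint U)) F) = F" "(I\<otimes>(cadjoint U)) ((I\<otimes>U) F) = F"
    by (simp_all add: id_tensor_compose[symmetric] id_tensor_ident)
qed

lemma tensor_P_perp: "(I\<otimes>P) F + (I\<otimes>(perp P)) F = F"
proof -
  obtain f where f: "f \<in> hardy_functions" "F = abs_hardy f" by (rule hardy_cases)
  have "P x + perp P x = x" for x
    by (simp add: perp_def)
  with f show ?thesis
    by (simp add: mult_tensor_id abs_hardy_add)
qed

lemma tensor_P_idem: "(I\<otimes>P) ((I\<otimes>P) F) = (I\<otimes>P) F"
proof -
  have "P \<circ> P = P" by (auto simp: P_idem)
  then show ?thesis by (simp add: id_tensor_compose[symmetric])
qed

text \<open>Splitting \<open>(I\<otimes>P) F\<close>, and applying \<open>I\<otimes>P\<close> to the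
  splitting of \<open>F\<close>, both leave a vanishing mixed term by idempotence.\<close>

lemma tensor_orthogonal:
  "(I\<otimes>P) ((I\<otimes>(perp P)) F) = 0" "(I\<otimes>(perp P)) ((I\<otimes>P) F) = 0"
  using tensor_P_perp[of "(I\<otimes>P) F"] arg_cong[OF tensor_P_perp[of F], of "I\<otimes>P"]
  by (simp_all add: tensor_P_idem id_tensor_add)

lemmas cinner_tensor =
  cinner_id_tensor_left[OF bounded(1) bounded(4) cinner_U]
  cinner_id_tensor_left[OF bounded(4) bounded(1) cinner_cadjoint_U]
  cinner_id_tensor_left[OF bounded(2) bounded(2) cinner_P]
  cinner_id_tensor_left[OF bounded(3) bounded(3) cinner_perp]

section \<open>Adjoints of the BCL pair\<close>

definition BCL1_adj :: "'s hardy \<Rightarrow> 's hardy" where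
  "BCL1_adj F = (I\<otimes>U) ((I\<otimes>P) F) + backward_shift ((I\<otimes>U) ((I\<otimes>(perp P)) F))"

definition BCL2_adj :: "'s hardy \<Rightarrow> 's hardy" where
  "BCL2_adj F = (I\<otimes>(perp P)) ((I\<otimes>(cadjoint U)) F)
    + backward_shift ((I\<otimes>P) ((I\<otimes>(cadjoint U)) F))"

lemma cinner_BCL1: "cinner (BCL1 U P F) G = cinner F (BCL1_adj G)"
  by (simp add: BCL1_def BCL1_adj_def shift_tensor_eq bounded_clinear_compose id_tensor_compose
      cinner_add_left cinner_add_right cinner_forward_shift_left cinner_tensor id_tensor_backward_shift)

lemma cinner_BCL2: "cinner (BCL2 U P F) G = cinner F (BCL2_adj G)"
  by (simp add: BCL2_def BCL2_adj_def shift_tensor_eq bounded_clinear_compose id_tensor_compose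
      cinner_add_left cinner_add_right cinner_forward_shift_left cinner_tensor id_tensor_backward_shift)

text \<open>\<open>cadjoint\<close> is a Hilbert choice; the two explicit formulas satisfy the
  defining equation and are therefore the chosen adjoints.\<close>

lemma cadjoint_BCL: "cadjoint (BCL1 U P) = BCL1_adj" "cadjoint (BCL2 U P) = BCL2_adj"
  by (rule cadjoint_unique, rule cinner_BCL1) (rule cadjoint_unique, rule cinner_BCL2)

lemmas tensor_simps = tensor_U tensor_orthogonal tensor_P_idem id_tensor_add id_tensor_backward_shift
  id_tensor_zero backward_shift_zero backward_shift_add

text \<open>The mixed products of \<open>P\<close> and \<open>perp P\<close> vanish. The two
  remaining terms each carry exactly one backward shift and recombine, since the projections sum to
  the identity.\<close>

lemma BCL_adj_commute: "BCL1_adj (BCL2_adj F) = backward_shift F" "BCL2_adj (BCL1_adj F) = backward_shift F"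
proof -
  have q: "(I\<otimes>(perp P)) ((I\<otimes>(perp P)) F) = (I\<otimes>(perp P)) F" for F
    using tensor_P_perp[of "(I\<otimes>(perp P)) F"] by (simp add: tensor_orthogonal)
  have "BCL1_adj (BCL2_adj F) = backward_shift ((I\<otimes>U)
      ((I\<otimes>P) ((I\<otimes>(cadjoint U)) F) + (I\<otimes>(perp P)) ((I\<otimes>(cadjoint U)) F)))"
    by (simp only: BCL1_adj_def BCL2_adj_def tensor_simps bounded q add_0_left add_0_right)
  then show "BCL1_adj (BCL2_adj F) = backward_shift F"
    by (simp only: tensor_P_perp tensor_U)
  have "BCL2_adj (BCL1_adj F) = backward_shift ((I\<otimes>P) F + (I\<otimes>(perp P)) F)"
    by (simp only: BCL1_adj_def BCL2_adj_def tensor_simps bounded q add_0_left add_0_right add.commute)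
  then show "BCL2_adj (BCL1_adj F) = backward_shift F"
    by (simp only: tensor_P_perp)
qed

text \<open>The backward shift commutes with the projections, so the two summands stay orthogonal.
  Only the shifted one loses norm, namely that of its constant coefficient.\<close>

lemma cinner_split:
  "cinner ((I\<otimes>P) F + backward_shift ((I\<otimes>(perp P)) F)) ((I\<otimes>P) F + backward_shift ((I\<otimes>(perp P)) F))
    = cinner F F - cinner (perp P (const_coeff F)) (perp P (const_coeff F))"
  "cinner ((I\<otimes>(perp P)) F + backward_shift ((I\<otimes>P) F)) ((I\<otimes>(perp P)) F + backward_shift ((I\<otimes>P) F))
    = cinner F F - cinner (P (const_coeff F)) (P (const_coeff F))"
proof -
  \<comment> \<open>Moving \<open>I\<otimes>P\<close> across the inner product makes it meet
    \<open>I\<otimes>(perp P)\<close>, and their product is zero.\<close>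
  have z: "cinner ((I\<otimes>P) X) ((I\<otimes>(perp P)) Y) = 0" "cinner ((I\<otimes>(perp P)) Y) ((I\<otimes>P) X) = 0" for X Y
    using cinner_zero_left[of X] cinner_zero_left[of Y]
    by (metis cinner_commute cinner_tensor(3) tensor_orthogonal(1) complex_cnj_zero)+
  have F: "cinner F F = cinner ((I\<otimes>P) F) ((I\<otimes>P) F) + cinner ((I\<otimes>(perp P)) F) ((I\<otimes>(perp P)) F)"
    using arg_cong2[OF tensor_P_perp[of F] tensor_P_perp[of F], of cinner]
    by (simp add: cinner_add_left cinner_add_right z)
  have b: "backward_shift ((I\<otimes>P) F) = (I\<otimes>P) (backward_shift F)"
    "backward_shift ((I\<otimes>(perp P)) F) = (I\<otimes>(perp P)) (backward_shift F)"
    by (simp_all add: id_tensor_backward_shift)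
  show "cinner ((I\<otimes>P) F + backward_shift ((I\<otimes>(perp P)) F)) ((I\<otimes>P) F + backward_shift ((I\<otimes>(perp P)) F))
    = cinner F F - cinner (perp P (const_coeff F)) (perp P (const_coeff F))"
    using cinner_backward_shift_self[of "(I\<otimes>(perp P)) F"]
    by (simp add: F b cinner_add_left cinner_add_right z const_coeff_id_tensor)
  show "cinner ((I\<otimes>(perp P)) F + backward_shift ((I\<otimes>P) F)) ((I\<otimes>(perp P)) F + backward_shift ((I\<otimes>P) F))
    = cinner F F - cinner (P (const_coeff F)) (P (const_coeff F))"
    using cinner_backward_shift_self[of "(I\<otimes>P) F"]
    by (simp add: F b cinner_add_left cinner_add_right z const_coeff_id_tensor)
qed

lemma cinner_BCL1_adj_self:
  "cinner (BCL1_adj F) (BCL1_adj F) = cinner F F - cinner (perp P (const_coeff F)) (perp P (const_coeff F))"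
proof -
  have "BCL1_adj F = (I\<otimes>U) ((I\<otimes>P) F + backward_shift ((I\<otimes>(perp P)) F))"
    by (simp add: BCL1_adj_def id_tensor_add id_tensor_backward_shift)
  then show ?thesis
    by (simp only: cinner_tensor tensor_U cinner_split)
qed

lemma cinner_BCL2_adj_self:
  "cinner (BCL2_adj F) (BCL2_adj F) = cinner F F
    - cinner (P (cadjoint U (const_coeff F))) (P (cadjoint U (const_coeff F)))"
  by (simp only: BCL2_adj_def cinner_split const_coeff_id_tensor bounded cinner_tensor tensor_U)

text \<open>Moving the outer factors across turns the four terms of the form into squared norms of
  adjoint images. They pair up so that the norm of \<open>F\<close> cancels; \<open>a\<close> and
  \<open>b\<close> are its Fourier coefficients of index 0 and 1.\<close>

lemma cinner_H_op:
  fixes F :: "'s hardy"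
  defines "a \<equiv> const_coeff F" and "b \<equiv> const_coeff (backward_shift F)"
  shows "cinner (H_op (BCL1 U P) (BCL2 U P) F) F = complex_of_real
    ((norm (P (cadjoint U (perp P (cadjoint U a) + P (cadjoint U b)))))\<^sup>2 - (norm (P a))\<^sup>2)"
proof -
  \<comment> \<open>The shifted summand of \<open>BCL2_adj F\<close> contributes the next
    coefficient of \<open>F\<close>, namely \<open>b\<close>.\<close>
  have G: "const_coeff (BCL2_adj F) = perp P (cadjoint U a) + P (cadjoint U b)"
    by (simp add: BCL2_adj_def const_coeff_add const_coeff_id_tensor
        id_tensor_backward_shift[symmetric] a_def b_def)
  \<comment> \<open>In the last term the two adjoints are taken in different orders on the two
    sides; both products equal the backward shift.\<close>
  have "cinner (H_op (BCL1 U P) (BCL2 U P) F) F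
      = cinner (BCL2_adj F) (BCL2_adj F) - cinner (BCL1_adj F) (BCL1_adj F)
        - cinner (BCL2_adj (BCL2_adj F)) (BCL2_adj (BCL2_adj F))
        + cinner (backward_shift F) (backward_shift F)"
    by (simp add: H_op_def cadjoint_BCL cinner_diff_left cinner_add_left cinner_BCL1 cinner_BCL2
        BCL_adj_commute)
  \<comment> \<open>The first and third terms leave the loss of norm of \<open>BCL2_adj F\<close>
    under another \<open>BCL2_adj\<close>. The other two leave the squared norm of
    \<open>perp P a\<close> minus that of \<open>a\<close>.\<close>
  also have "\<dots> = cinner (P (cadjoint U (const_coeff (BCL2_adj F)))) (P (cadjoint U (const_coeff (BCL2_adj F))))
      - cinner (P a) (P a)"
    unfolding cinner_BCL2_adj_self[of "BCL2_adj F"] cinner_BCL1_adj_self cinner_backward_shift_self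
      cinner_perp_self a_def
    by simp
  finally show ?thesis
    by (simp add: G cinner_self)
qed

lemma nonpositive_H_op_iff:
  "nonpositive_op (H_op (BCL1 U P) (BCL2 U P)) \<longleftrightarrow>
    (\<forall>a b. norm (P (cadjoint U (perp P (cadjoint U a) + P (cadjoint U b)))) \<le> norm (P a))"
    (is "?L \<longleftrightarrow> (\<forall>a b. ?Q a b)")
proof -
  have form: "cinner (H_op (BCL1 U P) (BCL2 U P) F) F \<le> 0 \<longleftrightarrow>
      ?Q (const_coeff F) (const_coeff (backward_shift F))" for F
    unfolding cinner_H_op by (simp add: less_eq_complex_def del: of_real_diff of_real_power)
  have "\<exists>F. const_coeff F = a \<and> const_coeff (backward_shift F) = b" for a b :: 's
    \<comment> \<open>The witness is the polynomial a + b z.\<close>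
    by (rule exI[of _ "const_hardy a + forward_shift (const_hardy b)"])
       (simp add: const_coeff_add backward_shift_add const_coeff_const_hardy backward_forward_shift
        const_coeff_forward_shift backward_shift_const_hardy)
  then show ?thesis
    unfolding nonpositive_op_def form by metis
qed

end

theorem proposition3p5:
  fixes U P A B D :: "'s::{complex_hilbert,second_countable_topology} \<Rightarrow> 's"
  assumes "BCL_triple U P"
  defines "A \<equiv> (\<lambda>s. (U \<circ> perp P \<circ> U \<circ> P \<circ> cadjoint U \<circ> perp P \<circ> cadjoint U) s - P s)"
    and "B \<equiv> U \<circ> perp P \<circ> U \<circ> P \<circ> cadjoint U \<circ> P \<circ> cadjoint U"
    and "D \<equiv> U \<circ> P \<circ> U \<circ> P \<circ> cadjoint U \<circ> P \<circ> cadjoint U"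
  shows "nonpositive_op (H_op (BCL1 U P) (BCL2 U P)) \<longleftrightarrow>
    nonpositive_op A \<and> nonpositive_op D \<and>
    (\<forall>s. complex_of_real ((cmod (cinner (B s) s))\<^sup>2) \<le> cinner (A s) s * cinner (D s) s)"
proof -
  interpret bcl_triple U P by unfold_locales (rule assms)
  \<comment> \<open>With X and Y denoting these two operators, A = X* X - P, B = X* Y and D = Y*
    Y.\<close>
  let ?X = "\<lambda>s. P (cadjoint U (perp P (cadjoint U s)))"
  let ?Y = "\<lambda>s. P (cadjoint U (P (cadjoint U s)))"
  have zero: "U 0 = 0" "P 0 = 0" "cadjoint U 0 = 0" "perp P 0 = 0"
    by (simp_all add: bounded_clinear_zero)
  have "cinner (A s) s = complex_of_real ((norm (?X s))\<^sup>2 - (norm (P s))\<^sup>2)" for s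
    by (simp add: A_def cinner_diff_left cinner_U cinner_perp cinner_P_self[symmetric] cinner_self)
  then have A: "nonpositive_op A \<longleftrightarrow> (\<forall>s. norm (?X s) \<le> norm (P s))"
    by (simp add: nonpositive_op_def less_eq_complex_def del: of_real_diff of_real_power)
  have D': "cinner (D s) s = complex_of_real ((norm (?Y s))\<^sup>2)" for s
  proof -
    have "cinner (D s) s = cinner (P (cadjoint U (P (cadjoint U s)))) (cadjoint U (P (cadjoint U s)))"
      \<comment> \<open>The restricted instance of \<open>cinner_P\<close> moves only a projection
        applied directly to a value of \<open>U\<close>, so the inner \<open>P\<close> is kept for
        \<open>cinner_P_self\<close>.\<close>
      by (simp only: D_def comp_apply cinner_U cinner_P[of "U _"])
    then show ?thesis
      by (simp only: cinner_P_self[symmetric] cinner_self)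
  qed
  then have D: "nonpositive_op D \<longleftrightarrow> (\<forall>s. ?Y s = 0)"
    by (simp add: nonpositive_op_def less_eq_complex_def del: of_real_power)
  have split: "P (cadjoint U (perp P (cadjoint U a) + P (cadjoint U b))) = ?X a + ?Y b" for a b
    by (simp add: bounded_clinear_apply_add)
  have "(\<forall>a b. norm (?X a + ?Y b) \<le> norm (P a)) \<longleftrightarrow>
      (\<forall>s. norm (?X s) \<le> norm (P s)) \<and> (\<forall>s. ?Y s = 0)" (is "?L \<longleftrightarrow> ?R")
  proof
    assume L: ?L
    have "norm (?X s) \<le> norm (P s)" "?Y s = 0" for s
      \<comment> \<open>Setting the second coefficient to zero isolates the condition on
        \<open>A\<close>. Setting the first to zero makes the bound zero and forces
        \<open>?Y s = 0\<close>.\<close>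
      using L[rule_format, of s 0] L[rule_format, of 0 s] by (simp_all add: zero)
    then show ?R by blast
  qed simp
  then have H: "nonpositive_op (H_op (BCL1 U P) (BCL2 U P)) \<longleftrightarrow> nonpositive_op A \<and> nonpositive_op D"
    by (simp only: nonpositive_H_op_iff split A D)
  have "complex_of_real ((cmod (cinner (B s) s))\<^sup>2) \<le> cinner (A s) s * cinner (D s) s"
    if "nonpositive_op D" for s
  proof -
    have "?Y s = 0" using that D by blast
    \<comment> \<open>\<open>B s\<close> is the image of \<open>?Y s\<close> under a linear map, so
      both sides of the inequality are zero.\<close>
    then have "B s = 0" "cinner (D s) s = 0"
      by (simp_all add: B_def D' zero)
    then show ?thesis by (simp add: cinner_zero_left)
  qed
  then show ?thesis using H by blast
qed

end
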